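(* Let $p>1$. Then $$(p+1)\frac{\sin_p(x)}{x}+\frac{1}{\cos_p(x)}>p+2\quad\text{for } x\in(0,\pi_p/2),$$ and $$(p+1)\frac{\sinh_p(x)}{x}+\frac{1}{\cosh_p(x)}>p+2\quad\text{for } x>0.$$
   Context: For $1<p<\infty$ define $\arcsin_p(x)=\int_0^x (1-t^p)^{-1/p}\,dt$ for $0\le x\le 1$, and $\pi_p/2=\arcsin_p(1)$. The generalized sine $\sin_p:[0,\pi_p/2]\to[0,1]$ is the inverse of $\arcsin_p$, and $\cos_p(x)=\frac{d}{dx}\sin_p(x)=(1-\sin_p(x)^p)^{1/p}$ on $[0,\pi_p/2]$. Define $\mathrm{arcsinh}_p(x)=\int_0^x (1+t^p)^{-1/p}\,dt$ for $x\ge 0$; $\sinh_p:[0,\infty)\to[0,\infty)$ is the inverse of $\mathrm{arcsinh}_p$, and $\cosh_p(x)=\frac{d}{dx}\sinh_p(x)$, which satisfies $\cosh_p(x)^p-\sinh_p(x)^p=1$ for $x\ge0$. *)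

theory Defs
  imports "HOL-Analysis.Analysis"
begin

text \<open>
  The integrand below is unbounded at \<open>1\<close>; the integral over \<open>{0..1}\<close> is the improper one,
  since the Henstock--Kurzweil integral does not depend on the value at that point.
\<close>

definition arcsin_p :: "real \<Rightarrow> real \<Rightarrow> real" where
  "arcsin_p p x = integral {0..x} (\<lambda>t. (1 - t powr p) powr (- 1 / p))"

definition pi_p :: "real \<Rightarrow> real" where
  "pi_p p = 2 * arcsin_p p 1"

definition sin_p :: "real \<Rightarrow> real \<Rightarrow> real" where
  "sin_p p = inv_into {0..1} (arcsin_p p)"

text \<open>
  The derivatives defining \<open>cos_p\<close> and \<open>cosh_p\<close> are taken within the domains of \<open>sin_p\<close> and
  \<open>sinh_p\<close>, hence one-sided at the endpoints, because \<open>inv_into\<close> is unspecified outside.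
\<close>

definition cos_p :: "real \<Rightarrow> real \<Rightarrow> real" where
  "cos_p p x = vector_derivative (sin_p p) (at x within {0..pi_p p / 2})"

definition arcsinh_p :: "real \<Rightarrow> real \<Rightarrow> real" where
  "arcsinh_p p x = integral {0..x} (\<lambda>t. (1 + t powr p) powr (- 1 / p))"

definition sinh_p :: "real \<Rightarrow> real \<Rightarrow> real" where
  "sinh_p p = inv_into {0..} (arcsinh_p p)"

definition cosh_p :: "real \<Rightarrow> real \<Rightarrow> real" where
  "cosh_p p x = vector_derivative (sinh_p p) (at x within {0..})"

end

theory Submission
  imports Defs
begin

text \<open>
  Put \<open>s = sin_p x\<close>, so that \<open>x = A s\<close> with \<open>A' = 1 / c\<close> and \<open>c = (1 - s\<^sup>p)\<^sup>1\<^sup>/\<^sup>p\<close>; the hyperbolic case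
  has \<open>1 + s\<^sup>p\<close> instead. Both satisfy \<open>s c' = c - c\<^sup>1\<^sup>-\<^sup>p\<close>. If \<open>(p + 2) c \<le> 1\<close>, the inequality is
  trivial; otherwise it says \<open>A s < G s\<close> for \<open>G s = (p + 1) s c / ((p + 2) c - 1)\<close>. As
  \<open>A 0 = G 0 = 0\<close>, it is enough that \<open>G' > 1 / c\<close>. With \<open>u = 1 / c\<close> and Bernoulli's inequality
  \<open>u\<^sup>p \<ge> 1 + p (u - 1)\<close> this reduces to \<open>(u - 1)\<^sup>2 ((p + 1) (p + 2) - u) > 0\<close>.
\<close>

section \<open>Elementary inequalities and the comparison of \<open>A\<close> with
  \<open>G\<close>\<close>

text \<open>By convexity the graph of \<open>x powr p\<close> lies above its tangent at 1.
  First-order contact at 1 is what later produces the double root \<open>u = 1\<close>.\<close>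

lemma powr_ge_Bernoulli:
  fixes u p :: real
  assumes "u > 0" "p \<ge> 1"
  shows "1 + p * (u - 1) \<le> u powr p"
proof -
  have "convex_on {0<..} (\<lambda>x::real. x powr p)"
  proof (rule f''_ge0_imp_convex)
    show "((\<lambda>x. x powr p) has_real_derivative p * x powr (p - 1)) (at x)" if "x \<in> {0<..}" for x
      using that by (auto intro!: derivative_eq_intros)
    show "((\<lambda>x. p * x powr (p - 1)) has_real_derivative p * ((p - 1) * x powr (p - 1 - 1))) (at x)"
      if "x \<in> {0<..}" for x
      using that by (auto intro!: derivative_eq_intros)
  qed (use assms in auto)
  then have "u powr p - 1 powr p \<ge> p * 1 powr (p - 1) * (u - 1)"
    by (rule convex_on_imp_above_tangent[where A = "{0<..}"])
      (use assms in \<open>auto intro!: derivative_eq_intros simp: connected_Ioi interior_open\<close>)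
  then show ?thesis by simp
qed

text \<open>The sides are \<open>A'\<close> and \<open>G'\<close>, the latter with the derivative of
  \<open>c\<close> eliminated. They agree at \<open>c = 1\<close>, so strictness rests on
  \<open>c \<noteq> 1\<close>.\<close>

lemma comparison_derivative_gt:
  fixes p c :: real
  assumes "p > 1" "c > 0" "c \<noteq> 1" "(p + 2) * c > 1"
  shows "1 / c < (p + 1) * ((p + 2) * c\<^sup>2 - 2 * c + c powr (1 - p)) / ((p + 2) * c - 1)\<^sup>2"
proof -
  define u where "u = 1 / c"
  define m where "m = (p + 1) * (p + 2)"
  have c: "c = 1 / u" and u: "u > 0" "u \<noteq> 1" "u < p + 2"
    using assms by (auto simp: u_def field_simps)
  have "p + 2 < m" using mult_strict_right_mono[of 1 "p + 1" "p + 2"] assms by (simp add: m_def)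
  then have pos: "(u - 1)\<^sup>2 * (m - u) > 0" using u by simp
  have cp: "c powr (1 - p) = u powr p / u"
    using u by (simp add: c powr_divide powr_diff divide_simps)
  have "(p + 1) * (1 + p * (u - 1)) \<le> (p + 1) * u powr p"
    using powr_ge_Bernoulli[of u p] u assms by simp
  \<comment> \<open>With denominators cleared, this expression is the right side of the claim minus
    the left side, expanded in \<open>u\<close>.\<close>
  then have "m - (p\<^sup>2 + 6*p + 6) * u + 2 * (p + 2) * u\<^sup>2 - u^3 + (p + 1) * u powr p * u
      \<ge> m - (p\<^sup>2 + 6*p + 6) * u + 2 * (p + 2) * u\<^sup>2 - u^3 + (p + 1) * (1 + p * (u - 1)) * u"
    using u by (intro add_left_mono mult_right_mono) auto
  also have "m - (p\<^sup>2 + 6*p + 6) * u + 2 * (p + 2) * u\<^sup>2 - u^3 + (p + 1) * (1 + p * (u - 1)) * u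
      = (u - 1)\<^sup>2 * (m - u)"
    by (simp add: m_def algebra_simps power2_eq_square power3_eq_cube)
  finally have "0 < m - (p\<^sup>2 + 6*p + 6) * u + 2 * (p + 2) * u\<^sup>2 - u^3 + (p + 1) * u powr p * u"
    using pos by linarith
  then have *: "u * (p + 2 - u)\<^sup>2 < (p + 1) * ((p + 2) - 2 * u + u powr p * u)"
    by (simp add: m_def algebra_simps power2_eq_square power3_eq_cube)
  have "(p + 2) * c\<^sup>2 - 2 * c + c powr (1 - p) = ((p + 2) - 2 * u + u powr p * u) / u\<^sup>2"
    unfolding cp using u by (simp add: c field_simps power2_eq_square)
  moreover have "((p + 2) * c - 1)\<^sup>2 = (p + 2 - u)\<^sup>2 / u\<^sup>2"
    using u by (simp add: c field_simps power2_eq_square)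
  moreover have "(p + 2 - u)\<^sup>2 > 0" using u by simp
  ultimately show ?thesis
    using * u by (simp add: c pos_less_divide_eq)
qed

text \<open>Abstracts what the circular and hyperbolic cases share. Derivatives are asked for only
  inside the interval; continuity on \<open>{0..s}\<close> carries monotonicity to the endpoints.
  The hypothesis \<open>cbig\<close> keeps the denominator of \<open>G\<close> positive on all of
  \<open>{0..s}\<close>, not just at \<open>s\<close>.\<close>

lemma quotient_inequality:
  fixes p s :: real and A c :: "real \<Rightarrow> real"
  assumes p: "p > 1" and s: "s > 0"
    and A0: "A 0 = 0" and contA: "continuous_on {0..s} A"
    and contc: "continuous_on {0..s} c"
    and derA: "\<And>t. 0 < t \<Longrightarrow> t < s \<Longrightarrow> (A has_real_derivative 1 / c t) (at t)"
    and derc: "\<And>t. 0 < t \<Longrightarrow> t < s \<Longrightarrow>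
      (c has_real_derivative (c t - c t powr (1 - p)) / t) (at t)"
    and cpos: "\<And>t. 0 \<le> t \<Longrightarrow> t \<le> s \<Longrightarrow> c t > 0"
    and c1: "\<And>t. 0 < t \<Longrightarrow> t < s \<Longrightarrow> c t \<noteq> 1"
    and cbig: "\<And>t. (p + 2) * c s > 1 \<Longrightarrow> 0 \<le> t \<Longrightarrow> t \<le> s \<Longrightarrow> (p + 2) * c t > 1"
  shows "(p + 1) * (s / A s) + 1 / c s > p + 2"
proof -
  have "A 0 < A s"
  proof (rule DERIV_pos_imp_increasing_open[OF s])
    show "\<exists>y. DERIV A t :> y \<and> y > 0" if "0 < t" "t < s" for t
      using derA[OF that] cpos[of t] that by auto
  qed (fact contA)
  then have As: "A s > 0" using A0 by simp
  have cs: "c s > 0" using cpos[of s] s by simp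
  show ?thesis
  proof (cases "(p + 2) * c s > 1")
    case False
    then have "1 / c s \<ge> p + 2" using cs by (simp add: field_simps)
    moreover have "(p + 1) * (s / A s) > 0" using p s As by simp
    ultimately show ?thesis by linarith
  next
    case True
    have D: "(p + 2) * c t - 1 > 0" if "0 \<le> t" "t \<le> s" for t
      using cbig[OF True that] by simp
    define G where "G = (\<lambda>t. (p + 1) * t * c t / ((p + 2) * c t - 1))"
    have "G 0 - A 0 < G s - A s"
    proof (rule DERIV_pos_imp_increasing_open[OF s])
      fix t assume t: "0 < t" "t < s"
      define d where "d = (c t - c t powr (1 - p)) / t"
      have td: "t * d = c t - c t powr (1 - p)" using t by (simp add: d_def)
      have Dt: "(p + 2) * c t - 1 > 0" using D[of t] t by simp
      have "(G has_real_derivative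
          (((p + 1) * c t + d * ((p + 1) * t)) * ((p + 2) * c t - 1)
             - (p + 1) * t * c t * ((p + 2) * d))
          / (((p + 2) * c t - 1) * ((p + 2) * c t - 1))) (at t)"
        unfolding G_def using Dt t by (auto intro!: derivative_eq_intros derc[OF t, folded d_def])
      \<comment> \<open>The products of \<open>c t\<close> with \<open>t * d\<close> cancel, so
        \<open>d\<close> survives only in \<open>t * d\<close>, which the differential equation for
        \<open>c\<close> eliminates.\<close>
      also have "((p + 1) * c t + d * ((p + 1) * t)) * ((p + 2) * c t - 1)
             - (p + 1) * t * c t * ((p + 2) * d)
          = (p + 1) * (c t * ((p + 2) * c t - 1) - t * d)"
        by (simp add: algebra_simps)
      also have "c t * ((p + 2) * c t - 1) - t * d
          = (p + 2) * (c t)\<^sup>2 - 2 * c t + c t powr (1 - p)"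
        using td by (simp add: algebra_simps power2_eq_square)
      finally have derG: "(G has_real_derivative (p + 1) * ((p + 2) * (c t)\<^sup>2 - 2 * c t
          + c t powr (1 - p)) / ((p + 2) * c t - 1)\<^sup>2) (at t)"
        by (simp add: power2_eq_square)
      show "\<exists>y. DERIV (\<lambda>t. G t - A t) t :> y \<and> y > 0"
      proof (rule exI, rule conjI[OF DERIV_diff[OF derG derA[OF t]]])
        show "0 < (p + 1) * ((p + 2) * (c t)\<^sup>2 - 2 * c t + c t powr (1 - p)) / ((p + 2) * c t - 1)\<^sup>2
            - 1 / c t"
          using comparison_derivative_gt[OF p cpos[of t] c1[OF t]] t Dt by simp
      qed
    next
      show "continuous_on {0..s} (\<lambda>t. G t - A t)"
        unfolding G_def using D
        by (intro continuous_intros contA contc) (metis atLeastAtMost_iff less_irrefl)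
    qed
    then have "A s < G s" by (simp add: G_def A0)
    then have "A s * ((p + 2) * c s - 1) < (p + 1) * s * c s"
      using D[of s] s by (simp add: G_def pos_less_divide_eq)
    then show ?thesis using As cs by (simp add: field_simps)
  qed
qed

section \<open>Differentiation of inverse functions and of the defining integrals\<close>

text \<open>The set \<open>S\<close> may exceed \<open>{a..b}\<close>: for \<open>sinh_p\<close> it
  is the half-line, and \<open>b\<close> is any point whose image exceeds \<open>x\<close>.\<close>

lemma has_real_derivative_inv_into:
  fixes f f' :: "real \<Rightarrow> real"
  assumes ab: "a < b" "{a..b} \<subseteq> S" and inj: "inj_on f S" and cont: "continuous_on {a..b} f"
    and der: "\<And>t. a < t \<Longrightarrow> t < b \<Longrightarrow> (f has_real_derivative f' t) (at t)"
    and nz: "\<And>t. a < t \<Longrightarrow> t < b \<Longrightarrow> f' t \<noteq> 0"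
    and x: "f a < x" "x < f b"
  obtains s where "a < s" "s < b" "f s = x" "inv_into S f x = s"
    "(inv_into S f has_real_derivative inverse (f' s)) (at x)"
proof -
  have onto: "\<exists>s. a \<le> s \<and> s \<le> b \<and> f s = y" if "f a < y" "y < f b" for y
    using IVT'[of f a y b] that ab cont by auto
  obtain s where s: "a \<le> s" "s \<le> b" "f s = x" using onto[OF x] by auto
  then have s': "a < s" "s < b" using x by (auto simp: order.strict_iff_order)
  have g: "inv_into S f (f t) = t" if "a \<le> t" "t \<le> b" for t
    using inj ab that by (intro inv_into_f_f) auto
  have gx: "inv_into S f x = s" using g[OF s(1,2)] s(3) by simp
  have "isCont (inv_into S f) (f s)"
  proof (rule isCont_inverse_function2[where f = f and x = s])
    \<comment> \<open>The midpoints keep the neighbourhood of \<open>s\<close> inside the open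
      interval, where differentiability gives two-sided continuity of \<open>f\<close>.\<close>
    show "(a + s) / 2 < s" "s < (s + b) / 2" using s' by auto
    show "inv_into S f (f z) = z" if "(a + s) / 2 \<le> z" "z \<le> (s + b) / 2" for z
      using that s' by (intro g) auto
    show "isCont f z" if "(a + s) / 2 \<le> z" "z \<le> (s + b) / 2" for z
      using that s' by (intro DERIV_isCont[OF der]) auto
  qed
  then have isC: "isCont (inv_into S f) x" by (simp only: s(3))
  have "(inv_into S f has_real_derivative inverse (f' s)) (at x)"
  proof (rule DERIV_inverse_function[where f = f and a = "f a" and b = "f b"])
    show "(f has_real_derivative f' s) (at (inv_into S f x))" using der[OF s'] by (simp only: gx)
    show "f (inv_into S f y) = y" if "f a < y" "y < f b" for y
      using onto[OF that] g by auto
  qed (fact nz[OF s'] x isC)+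
  then show thesis using that s' s(3) gx by blast
qed

text \<open>Below, \<open>e\<close> is \<open>-1\<close> for \<open>arcsin_p\<close> and \<open>1\<close> for \<open>arcsinh_p\<close>.\<close>

lemma has_real_derivative_powr_root:
  fixes p e t :: real
  assumes "p > 1" "t > 0" "1 + e * t powr p > 0"
  defines "c \<equiv> \<lambda>t. (1 + e * t powr p) powr (1 / p)"
  shows "(c has_real_derivative (c t - c t powr (1 - p)) / t) (at t)"
proof -
  have "(c has_real_derivative
      (1 / p) * (1 + e * t powr p) powr (1 / p - 1) * (e * (p * t powr (p - 1)))) (at t)"
    unfolding c_def using assms(1-3) by (auto intro!: derivative_eq_intros)
  moreover have "c t powr (1 - p) = (1 + e * t powr p) powr (1 / p - 1)"
    using assms(1) by (simp add: c_def powr_powr diff_divide_distrib)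
  moreover have "c t = (1 + e * t powr p) * (1 + e * t powr p) powr (1 / p - 1)"
    using assms(3) by (simp add: c_def powr_diff)
  moreover have "t powr (p - 1) = t powr p / t" using assms(2) by (simp add: powr_diff)
  ultimately show ?thesis
    using assms(1,2) by (simp add: algebra_simps)
qed

lemma indefinite_integral_has_real_derivative:
  fixes p e b t :: real
  assumes "p > 1" and pos: "\<And>t. 0 \<le> t \<Longrightarrow> t < b \<Longrightarrow> 1 + e * t powr p > 0"
    and t: "0 < t" "t < b"
  shows "((\<lambda>x. integral {0..x} (\<lambda>t. (1 + e * t powr p) powr (- 1 / p)))
    has_real_derivative 1 / (1 + e * t powr p) powr (1 / p)) (at t)"
proof -
  \<comment> \<open>For \<open>e = -1\<close>, \<open>b = 1\<close> the integrand is unbounded near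
    \<open>b\<close>; stopping at \<open>d\<close> leaves a compact interval on which it is
    continuous.\<close>
  obtain d where d: "t < d" "d < b" using t dense by blast
  have "continuous_on {0..d} (\<lambda>t. (1 + e * t powr p) powr (- 1 / p))"
    using assms d by (intro continuous_intros continuous_on_powr') force+
  from integral_has_real_derivative[OF this, of t] show ?thesis
    using t d by (simp add: at_within_Icc_at powr_minus field_simps)
qed

section \<open>The generalized sine\<close>

lemma sin_p_inequality:
  assumes p: "p > 1" and x: "0 < x" "x < pi_p p / 2"
  shows "(p + 1) * (sin_p p x / x) + 1 / cos_p p x > p + 2"
proof -
  define c where "c = (\<lambda>t. (1 + (-1) * t powr p) powr (1 / p))"
  have A_def: "arcsin_p p = (\<lambda>x. integral {0..x} (\<lambda>t. (1 + (-1) * t powr p) powr (- 1 / p)))"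
    by (simp add: arcsin_p_def fun_eq_iff)
  have lt1: "t powr p < 1" if "0 \<le> t" "t < 1" for t
    using powr_less_mono2[of p t 1] that p by simp
  have cpos: "c t > 0" if "0 \<le> t" "t < 1" for t
    using lt1[OF that] by (simp add: c_def)
  have der: "(arcsin_p p has_real_derivative 1 / c t) (at t)" if "0 < t" "t < 1" for t
    unfolding A_def c_def
    by (rule indefinite_integral_has_real_derivative[where b = 1]) (use p lt1 that in auto)
  text \<open>Otherwise \<open>pi_p p\<close> has the junk value 0 and there is no such \<open>x\<close>.\<close>
  have "(\<lambda>t. (1 + (-1) * t powr p) powr (- 1 / p)) integrable_on {0..1}"
    using x not_integrable_integral by (fastforce simp: pi_p_def A_def)
  then have cont: "continuous_on {0..1} (arcsin_p p)"
    unfolding A_def by (rule indefinite_integral_continuous_1)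
  have less: "arcsin_p p s < arcsin_p p t" if "0 \<le> s" "s < t" "t \<le> 1" for s t
  proof (rule DERIV_pos_imp_increasing_open[OF that(2)])
    show "\<exists>y. DERIV (arcsin_p p) r :> y \<and> y > 0" if "s < r" "r < t" for r
      using der[of r] cpos[of r] that \<open>0 \<le> s\<close> \<open>t \<le> 1\<close> by auto
    show "continuous_on {s..t} (arcsin_p p)"
      using that by (intro continuous_on_subset[OF cont]) auto
  qed
  then have inj: "inj_on (arcsin_p p) {0..1}"
    by (intro strict_mono_on_imp_inj_on strict_mono_onI) auto
  have A0: "arcsin_p p 0 = 0" by (simp add: A_def)
  obtain s where s: "0 < s" "s < 1" "arcsin_p p s = x" "sin_p p x = s"
    and ders: "(sin_p p has_real_derivative inverse (1 / c s)) (at x)"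
    unfolding sin_p_def
  proof (rule has_real_derivative_inv_into[OF zero_less_one order_refl inj cont der])
    show "1 / c t \<noteq> 0" if "0 < t" "t < 1" for t using cpos[of t] that by simp
    show "arcsin_p p 0 < x" "x < arcsin_p p 1" using x by (simp_all add: A0 pi_p_def)
  qed
  have "cos_p p x = c s"
    unfolding cos_p_def using ders x
    by (auto simp: at_within_Icc_at has_real_derivative_iff_has_vector_derivative
        intro: vector_derivative_at)
  moreover have "(p + 1) * (s / arcsin_p p s) + 1 / c s > p + 2"
  proof (rule quotient_inequality[where A = "arcsin_p p" and c = c, OF p s(1) A0])
    show "continuous_on {0..s} (arcsin_p p)" using s by (intro continuous_on_subset[OF cont]) auto
    show "continuous_on {0..s} c"
      unfolding c_def using p s lt1 by (intro continuous_intros continuous_on_powr') force+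
    show "(c has_real_derivative (c t - c t powr (1 - p)) / t) (at t)" if "0 < t" "t < s" for t
      unfolding c_def by (rule has_real_derivative_powr_root) (use p that s lt1[of t] in auto)
    show "c t \<noteq> 1" if "0 < t" "t < s" for t
    proof -
      have "c t < 1 powr (1 / p)"
        unfolding c_def using lt1[of t] that s p by (intro powr_less_mono2) auto
      then show ?thesis by simp
    qed
    show "(p + 2) * c t > 1" if "(p + 2) * c s > 1" "0 \<le> t" "t \<le> s" for t
    proof -
      \<comment> \<open>Here \<open>c\<close> is decreasing, so the bound at \<open>s\<close> passes
        to all smaller \<open>t\<close>.\<close>
      have "c s \<le> c t"
        unfolding c_def using lt1[of s] that s p by (intro powr_mono2) (auto intro: powr_mono2)
      then have "(p + 2) * c s \<le> (p + 2) * c t" using p by simp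
      then show ?thesis using that by simp
    qed
  qed (use s der cpos in auto)
  ultimately show ?thesis using s by simp
qed

section \<open>The generalized hyperbolic sine\<close>

text \<open>Divided by \<open>(1 + t) powr p\<close>, the left side is a sum of \<open>p\<close>-th
  powers of two numbers in \<open>{0..1}\<close> with sum 1, and such powers do not exceed their
  bases.\<close>

lemma one_plus_powr_le:
  fixes p t :: real
  assumes "p \<ge> 1" "t > 0"
  shows "1 + t powr p \<le> (1 + t) powr p"
proof -
  have "(1 / (1 + t)) powr p \<le> 1 / (1 + t)" "(t / (1 + t)) powr p \<le> t / (1 + t)"
    using powr_mono'[of 1 p "1 / (1 + t)"] powr_mono'[of 1 p "t / (1 + t)"] assms by auto
  then have "(1 / (1 + t)) powr p + (t / (1 + t)) powr p \<le> 1 / (1 + t) + t / (1 + t)"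
    by (rule add_mono)
  also have "\<dots> = 1" using assms by (simp add: field_simps)
  finally show ?thesis using assms by (simp add: powr_divide field_simps)
qed

lemma sinh_p_inequality:
  assumes p: "p > 1" and x: "0 < x"
  shows "(p + 1) * (sinh_p p x / x) + 1 / cosh_p p x > p + 2"
proof -
  define c where "c = (\<lambda>t. (1 + 1 * t powr p) powr (1 / p))"
  have A_def: "arcsinh_p p = (\<lambda>x. integral {0..x} (\<lambda>t. (1 + 1 * t powr p) powr (- 1 / p)))"
    by (simp add: arcsinh_p_def fun_eq_iff)
  have pos: "1 + 1 * t powr p > 0" for t by (simp add: add_pos_nonneg)
  have cpos: "c t > 0" for t using pos[of t] by (simp add: c_def)
  have der: "(arcsinh_p p has_real_derivative 1 / c t) (at t)" if "0 < t" for t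
    unfolding A_def c_def
    by (rule indefinite_integral_has_real_derivative[where b = "t + 1"])
      (use p that pos in auto)
  have cont: "continuous_on {0..b} (arcsinh_p p)" for b
    unfolding A_def using p pos
    by (intro indefinite_integral_continuous_1 integrable_continuous_real continuous_intros
        continuous_on_powr') (force simp: add_nonneg_eq_0_iff)+
  have less: "arcsinh_p p s < arcsinh_p p t" if "0 \<le> s" "s < t" for s t
  proof (rule DERIV_pos_imp_increasing_open[OF that(2)])
    show "\<exists>y. DERIV (arcsinh_p p) r :> y \<and> y > 0" if "s < r" "r < t" for r
      using der[of r] cpos[of r] that \<open>0 \<le> s\<close> by auto
    show "continuous_on {s..t} (arcsinh_p p)"
      using that by (intro continuous_on_subset[OF cont]) auto
  qed
  then have inj: "inj_on (arcsinh_p p) {0..}"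
    by (intro strict_mono_on_imp_inj_on strict_mono_onI) auto
  have A0: "arcsinh_p p 0 = 0" by (simp add: A_def)
  \<comment> \<open>A logarithmic lower bound shows that \<open>arcsinh_p p\<close> is unbounded, so
    every \<open>x > 0\<close> is one of its values.\<close>
  have ln_le: "ln (1 + b) \<le> arcsinh_p p b" if "0 \<le> b" for b
  proof -
    have "arcsinh_p p 0 - ln (1 + 0) \<le> arcsinh_p p b - ln (1 + b)"
    proof (rule DERIV_nonneg_imp_increasing_open[OF that])
      fix t :: real assume t: "0 < t" "t < b"
      have "c t \<le> ((1 + t) powr p) powr (1 / p)"
        unfolding c_def using one_plus_powr_le[of p t] p t pos[of t]
        by (intro powr_mono2) auto
      then have "c t \<le> 1 + t" using p t by (simp add: powr_powr)
      then have "1 / (1 + t) \<le> 1 / c t" using cpos[of t] t by (simp add: frac_le)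
      moreover have "((\<lambda>t. arcsinh_p p t - ln (1 + t)) has_real_derivative 1 / c t - 1 / (1 + t)) (at t)"
        using t by (auto intro!: derivative_eq_intros der)
      ultimately show "\<exists>y. DERIV (\<lambda>t. arcsinh_p p t - ln (1 + t)) t :> y \<and> 0 \<le> y"
        by (intro exI conjI) auto
    qed (intro continuous_intros cont, auto)
    then show ?thesis by (simp add: A0)
  qed
  \<comment> \<open>Chosen so that \<open>ln (1 + b) = x + 1 > x\<close>.\<close>
  define b where "b = exp (x + 1) - 1"
  have b: "0 < b" using x by (simp add: b_def)
  have xb: "x < arcsinh_p p b" using ln_le[of b] b by (simp add: b_def)
  obtain s where s: "0 < s" "arcsinh_p p s = x" "sinh_p p x = s"
    and ders: "(sinh_p p has_real_derivative inverse (1 / c s)) (at x)"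
    unfolding sinh_p_def
  proof (rule has_real_derivative_inv_into[OF b _ inj cont der])
    show "1 / c t \<noteq> 0" for t using cpos[of t] by simp
    show "arcsinh_p p 0 < x" "x < arcsinh_p p b" using x xb by (simp_all add: A0)
  qed auto
  have "at x within {0..} = at x"
    using x by (intro at_within_interior) (simp add: interior_Ici)
  then have "cosh_p p x = c s"
    unfolding cosh_p_def using ders
    by (auto simp: has_real_derivative_iff_has_vector_derivative intro: vector_derivative_at)
  moreover have "(p + 1) * (s / arcsinh_p p s) + 1 / c s > p + 2"
  proof (rule quotient_inequality[where A = "arcsinh_p p" and c = c, OF p s(1) A0 cont])
    have c1: "c t > 1" if "0 < t" for t
    proof -
      have "1 powr (1 / p) < c t"
        unfolding c_def using that p by (intro powr_less_mono2) auto
      then show ?thesis by simp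
    qed
    show "continuous_on {0..s} c"
      unfolding c_def using p
      by (intro continuous_intros continuous_on_powr') (force simp: add_nonneg_eq_0_iff)+
    show "(c has_real_derivative (c t - c t powr (1 - p)) / t) (at t)" if "0 < t" "t < s" for t
      unfolding c_def by (rule has_real_derivative_powr_root)
        (use p that pos[of t] in auto)
    show "c t \<noteq> 1" if "0 < t" for t using c1[OF that] by simp
    show "(p + 2) * c t > 1" if "0 \<le> t" for t
    proof -
      \<comment> \<open>In the hyperbolic case \<open>c\<close> never drops below 1, so the
        denominator of \<open>G\<close> is positive everywhere.\<close>
      have "c t \<ge> 1"
        by (cases "t = 0") (simp add: c_def, use c1[of t] that in simp)
      then have "(p + 2) * 1 \<le> (p + 2) * c t" using p by (intro mult_left_mono) auto
      then show ?thesis by (rule less_le_trans[rotated]) (use p in simp)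
    qed
  qed (use der cpos in auto)
  ultimately show ?thesis using s by simp
qed

theorem theorem3p13:
  fixes p :: real
  assumes "p > 1"
  shows "(\<forall>x\<in>{0<..<pi_p p / 2}. (p + 1) * (sin_p p x / x) + 1 / cos_p p x > p + 2) \<and>
         (\<forall>x>0. (p + 1) * (sinh_p p x / x) + 1 / cosh_p p x > p + 2)"
  using sin_p_inequality[OF assms] sinh_p_inequality[OF assms] by auto

end
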